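(* Let $n\ge 1$ and let $b\neq 0$ be an integer. There is a constant $C$, independent of the domain, such that for every convex domain $\Delta\subseteq\mathbb{R}^n$ (compact, of full dimension) of diameter $\omega\ge 1$, \[\left||\Delta_b| - \left(\prod_{p\mid b}\left(1-\frac{1}{p^{n}}\right)\right)\mathrm{vol}(\Delta)\right| \le C\,\omega^{n-1},\] i.e. the left-hand side is $O(\omega^{n-1})$. Here the product is over all distinct primes $p$ dividing $b$.
   Context: For a set $\Delta\subseteq\mathbb{R}^n$, $\Delta_1=\Delta\cap\mathbb{Z}^n$ denotes its set of integral points, and for an integer $b$, $\Delta_b=\{\vec x=(x_1,\dots,x_n)\in\Delta_1:\gcd(x_1,\dots,x_n,b)=1\}$. The diameter of a set is the supremum of distances between its points; $\mathrm{vol}$ is $n$-dimensional Lebesgue measure. *)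

theory Defs
  imports "HOL-Analysis.Analysis" "HOL-Computational_Algebra.Primes"
begin

definition integral_points :: "(real ^ 'n) set \<Rightarrow> (real ^ 'n) set" where
  "integral_points \<Delta> = {x \<in> \<Delta>. \<forall>i. x $ i \<in> \<int>}"

(* The floor only converts the integral coordinates from real to int.
   Gcd of the set of coordinates together with b is gcd(x_1, ..., x_n, b). *)
definition coprime_points :: "(real ^ 'n) set \<Rightarrow> int \<Rightarrow> (real ^ 'n) set" where
  "coprime_points \<Delta> b =
     {x \<in> integral_points \<Delta>. Gcd (insert b (range (\<lambda>i. \<lfloor>x $ i\<rfloor>))) = 1}"

end

theory Submission
  imports Defs
begin

text \<open>Translating a convex set by a vector of the unit cube changes its number of lattice points by
  \<open>O(\<omega> ^ (n - 1))\<close>: moving one coordinate at a time, each lattice line meets the set in an interval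
  and so changes the count by at most one. Averaging over the unit cube compares the count with the volume.
  Divisibility conditions are imposed one prime \<open>p\<close> at a time: the points that are divisible by \<open>p\<close>
  and satisfy the earlier conditions correspond to the points of \<open>\<Delta> / p\<close> satisfying these conditions.\<close>

section \<open>Crude bounds for the number of lattice points\<close>

text \<open>Subtracting a base point of \<open>A\<close> and keeping only the coordinates in
  \<open>I\<close> embeds \<open>A\<close> into a discrete cube. Taking all coordinates gives
  finiteness of bounded lattice sets; leaving out one coordinate counts lattice lines, which is the
  source of the exponent n - 1.\<close>

lemma card_integral_vectors_le:
  fixes A :: "(real ^ 'n) set"
  assumes int: "\<And>x i. x \<in> A \<Longrightarrow> x $ i \<in> \<int>"
    and close: "\<And>x y i. x \<in> A \<Longrightarrow> y \<in> A \<Longrightarrow> i \<in> I \<Longrightarrow> \<bar>x $ i - y $ i\<bar> \<le> w"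
    and inj: "\<And>x y. x \<in> A \<Longrightarrow> y \<in> A \<Longrightarrow> (\<And>i. i \<in> I \<Longrightarrow> x $ i = y $ i) \<Longrightarrow> x = y"
    and w: "0 \<le> w"
  shows "finite A" and "real (card A) \<le> (2 * w + 1) ^ card I"
proof -
  have "finite A \<and> real (card A) \<le> (2 * w + 1) ^ card I"
  proof (cases "A = {}")
    case True
    then show ?thesis using w by simp
  next
    case False
    then obtain a where a: "a \<in> A" by blast
    \<comment> \<open>Differences of coordinates are integers, so the real bound \<open>w\<close>
      may be replaced by its integer part; each coordinate then takes at most 2k + 1 values.\<close>
    define k where "k = \<lfloor>w\<rfloor>"
    have k: "0 \<le> k" "real_of_int k \<le> w" using w by (auto simp: k_def)
    let ?f = "\<lambda>x. \<lambda>i\<in>I. \<lfloor>x $ i\<rfloor> - \<lfloor>a $ i\<rfloor>"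
    have fl: "real_of_int \<lfloor>x $ i\<rfloor> = x $ i" if "x \<in> A" for x i
      using int[OF that, of i] by (metis Ints_cases floor_of_int)
    have inj_f: "inj_on ?f A"
    proof (rule inj_onI)
      fix x y assume xy: "x \<in> A" "y \<in> A" "?f x = ?f y"
      show "x = y"
      proof (rule inj[OF xy(1,2)])
        fix i assume "i \<in> I"
        then have "\<lfloor>x $ i\<rfloor> = \<lfloor>y $ i\<rfloor>" using fun_cong[OF xy(3), of i] by simp
        then show "x $ i = y $ i" using fl xy(1,2) by metis
      qed
    qed
    have im: "?f ` A \<subseteq> (\<Pi>\<^sub>E i\<in>I. {-k..k})"
    proof (rule image_subsetI, rule restrict_PiE_iff[THEN iffD2], rule ballI)
      fix x i assume x: "x \<in> A" and i: "i \<in> I"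
      have "real_of_int \<bar>\<lfloor>x $ i\<rfloor> - \<lfloor>a $ i\<rfloor>\<bar> \<le> w"
        using close[OF x a i] by (simp only: of_int_abs of_int_diff fl[OF x] fl[OF a])
      then have "\<bar>\<lfloor>x $ i\<rfloor> - \<lfloor>a $ i\<rfloor>\<bar> \<le> k" unfolding k_def by linarith
      then show "\<lfloor>x $ i\<rfloor> - \<lfloor>a $ i\<rfloor> \<in> {-k..k}" by auto
    qed
    have fin: "finite (\<Pi>\<^sub>E i\<in>I. {-k..k})" by (rule finite_PiE) auto
    have "card A \<le> card (\<Pi>\<^sub>E i\<in>I. {-k..k})"
      by (rule card_inj_on_le[OF inj_f im fin])
    also have "\<dots> = nat (2 * k + 1) ^ card I"
      by (subst card_PiE) (auto simp: algebra_simps)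
    finally have "real (card A) \<le> real (nat (2 * k + 1)) ^ card I"
      by (metis of_nat_le_iff of_nat_power)
    also have "\<dots> \<le> (2 * w + 1) ^ card I"
      using k by (intro power_mono) auto
    finally show ?thesis
      using inj_on_finite[OF inj_f im fin] by blast
  qed
  then show "finite A" "real (card A) \<le> (2 * w + 1) ^ card I" by auto
qed

lemma component_diff_le_diameter:
  fixes \<Delta> :: "(real ^ 'n) set"
  assumes "bounded \<Delta>" "x \<in> \<Delta>" "y \<in> \<Delta>"
  shows "\<bar>x $ i - y $ i\<bar> \<le> diameter \<Delta>"
proof -
  have "\<bar>x $ i - y $ i\<bar> \<le> norm (x - y)"
    using component_le_norm_cart[of "x - y" i] by simp
  also have "\<dots> \<le> diameter \<Delta>"
    using diameter_bounded_bound[OF assms] by (simp add: dist_norm)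
  finally show ?thesis .
qed

lemma diameter_translation:
  fixes S :: "'a :: real_normed_vector set"
  shows "diameter ((+) a ` S) = diameter S"
proof -
  have "case_prod dist ` ((+) a ` S \<times> (+) a ` S) = case_prod dist ` (S \<times> S)"
    by (force simp: image_iff)
  then show ?thesis by (simp add: diameter_def)
qed

lemma finite_integral_points:
  fixes \<Delta> :: "(real ^ 'n) set"
  assumes "bounded \<Delta>"
  shows "finite (integral_points \<Delta>)"
proof (rule card_integral_vectors_le(1)[where I = UNIV and w = "diameter \<Delta>"])
  show "0 \<le> diameter \<Delta>" by (rule diameter_ge_0[OF assms])
qed (auto simp: integral_points_def component_diff_le_diameter[OF assms] vec_eq_iff)

section \<open>Lattice points of translated convex sets\<close>

text \<open>This is how convexity enters the lattice count: the trace of the set on a line parallel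
  to a coordinate axis has no gaps.\<close>

lemma convex_axis_between:
  fixes x :: "real ^ 'n"
  assumes "convex \<Delta>" "x + axis i r \<in> \<Delta>" "x + axis i s \<in> \<Delta>" "r \<le> t" "t \<le> s"
  shows "x + axis i t \<in> \<Delta>"
proof (cases "r = s")
  case True
  then show ?thesis using assms by (metis order_antisym)
next
  case False
  define u where "u = (t - r) / (s - r)"
  have rs: "r < s" using False assms by simp
  then have u: "0 \<le> u" "u \<le> 1" using assms by (auto simp: u_def divide_simps)
  have t: "t = (1 - u) * r + u * s"
  proof -
    have "u * (s - r) = t - r" using rs by (simp add: u_def)
    then show ?thesis by (simp add: algebra_simps)
  qed
  have "(1 - u) *\<^sub>R (x + axis i r) + u *\<^sub>R (x + axis i s) \<in> \<Delta>"
    using assms u by (simp add: convex_alt)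
  also have "(1 - u) *\<^sub>R (x + axis i r) + u *\<^sub>R (x + axis i s) = x + axis i t"
    by (simp add: vec_eq_iff axis_def t algebra_simps)
  finally show ?thesis .
qed

text \<open>Only one point of each lattice line in direction \<open>i\<close> can lie in one of the two sets and
  not in the other: of two points in the same set, one is caught by convexity.\<close>

lemma card_integral_points_axis_translate:
  fixes \<Delta> :: "(real ^ 'n) set"
  assumes con: "convex \<Delta>" and bdd: "bounded \<Delta>" and t: "0 \<le> t" "t \<le> 1"
  shows "\<bar>real (card (integral_points \<Delta>)) - real (card (integral_points ((+) (- axis i t) ` \<Delta>)))\<bar>
    \<le> (2 * diameter \<Delta> + 1) ^ (CARD('n) - 1)" (is "_ \<le> ?B")
proof -
  define A where "A = integral_points \<Delta>"
  define B where "B = integral_points ((+) (- axis i t) ` \<Delta>)"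
  \<comment> \<open>Reading \<Delta> as its own translate by \<open>axis i 0\<close> gives
    \<open>A\<close> and \<open>B\<close> descriptions of the same shape, so that
    \<open>card_le\<close> serves both differences, with \<open>s = 0\<close> and
    \<open>s = t\<close>.\<close>
  have axis0: "axis i 0 = (0 :: real ^ 'n)" by (simp add: axis_eq_0_iff)
  have Aiff: "x \<in> A \<longleftrightarrow> x + axis i 0 \<in> \<Delta> \<and> (\<forall>j. x $ j \<in> \<int>)" for x
    by (auto simp: A_def integral_points_def axis0)
  have Biff: "x \<in> B \<longleftrightarrow> x + axis i t \<in> \<Delta> \<and> (\<forall>j. x $ j \<in> \<int>)" for x
    by (force simp: B_def integral_points_def image_iff)
  have fin: "finite A" "finite B"
    unfolding A_def B_def by (intro finite_integral_points bounded_translation bdd)+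
  \<comment> \<open>The assumption \<open>line\<close> allows at most one point of \<open>X\<close>
    on each lattice line in direction \<open>i\<close>, so the other n - 1 coordinates determine the
    point.\<close>
  have card_le: "real (card X) \<le> ?B"
    if int: "\<And>x j. x \<in> X \<Longrightarrow> x $ j \<in> \<int>" and mem: "\<And>x. x \<in> X \<Longrightarrow> x + axis i s \<in> \<Delta>"
      and line: "\<And>x m. x \<in> X \<Longrightarrow> x + axis i m \<in> X \<Longrightarrow> m \<in> \<int> \<Longrightarrow> m > 0 \<Longrightarrow> False" for X s
  proof -
    have "real (card X) \<le> (2 * diameter \<Delta> + 1) ^ card (UNIV - {i})"
    proof (rule card_integral_vectors_le(2))
      fix x y j assume "x \<in> X" "y \<in> X" "j \<in> UNIV - {i}"
      then show "\<bar>x $ j - y $ j\<bar> \<le> diameter \<Delta>"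
        using component_diff_le_diameter[OF bdd mem mem, of x y j] by (simp add: axis_def)
    next
      fix x y assume xy: "x \<in> X" "y \<in> X" and eq: "\<And>j. j \<in> UNIV - {i} \<Longrightarrow> x $ j = y $ j"
      have "y = x + axis i (y $ i - x $ i)" "x = y + axis i (x $ i - y $ i)"
        using eq by (auto simp: vec_eq_iff axis_def)
      moreover have "y $ i - x $ i \<in> \<int>" "x $ i - y $ i \<in> \<int>" using int xy by auto
      ultimately have "\<not> y $ i - x $ i > 0" "\<not> x $ i - y $ i > 0"
        using line xy by metis+
      then show "x = y" using eq by (auto simp: vec_eq_iff) (metis linorder_cases)
    qed (auto simp: int diameter_ge_0[OF bdd])
    then show ?thesis by simp
  qed
  have m1: "1 \<le> m" if "m \<in> \<int>" "m > 0" for m :: real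
    using that by (auto elim!: Ints_cases)
  have shift: "x + axis i m + axis i s = x + axis i (m + s)" for x :: "real ^ 'n" and m s
    by (simp add: vec_eq_iff axis_def)
  have "real (card (A - B)) \<le> ?B"
  proof (rule card_le[where s = 0])
    fix x m assume x: "x \<in> A - B" "x + axis i m \<in> A - B" and m: "m \<in> \<int>" "m > 0"
    \<comment> \<open>Here \<open>m\<close> is at least 1, hence at least \<open>t\<close>: the
      shifted point lies between \<open>x\<close> and \<open>x + axis i m\<close>, which puts the
      nearer point \<open>x\<close> into \<open>B\<close>.\<close>
    have "x + axis i t \<in> \<Delta>"
      using convex_axis_between[OF con, of x i 0 m t] x m1[OF m] t Aiff shift[of x m 0] by auto
    then show False using x Aiff Biff by auto
  qed (use Aiff in auto)
  moreover have "real (card (B - A)) \<le> ?B"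
  proof (rule card_le[where s = t])
    fix x m assume x: "x \<in> B - A" "x + axis i m \<in> B - A" and m: "m \<in> \<int>" "m > 0"
    \<comment> \<open>Now \<open>m\<close> lies between \<open>t\<close> and \<open>m + t\<close>,
      so it is the farther point \<open>x + axis i m\<close> that falls into
      \<open>A\<close>.\<close>
    have "x + axis i m + axis i 0 \<in> \<Delta>"
      using convex_axis_between[OF con, of x i t "m + t" m] x m1[OF m] t Biff shift[of x m]
      by (auto simp: axis0)
    then show False using x Aiff Biff by blast
  qed (use Biff in auto)
  \<comment> \<open>The common points cancel. The two remaining counts are nonnegative and enter
    with opposite signs, so the bound is \<open>?B\<close> and not twice \<open>?B\<close>.\<close>
  moreover have "card A = card (A \<inter> B) + card (A - B)" "card B = card (A \<inter> B) + card (B - A)"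
    using card_Int_Diff[of A B] card_Int_Diff[of B A] fin by (auto simp: Int_commute)
  ultimately show ?thesis unfolding A_def[symmetric] B_def[symmetric] by linarith
qed

text \<open>The translation is split into n moves, one per coordinate: \<open>T K\<close> uses the
  coordinates of \<open>v\<close> in \<open>K\<close> and zero elsewhere. All the \<open>T K\<close>
  have the same diameter, so every move costs the same bound.\<close>

lemma card_integral_points_translate:
  fixes \<Delta> :: "(real ^ 'n) set"
  assumes con: "convex \<Delta>" and bdd: "bounded \<Delta>" and v: "\<And>i. 0 \<le> v $ i" "\<And>i. v $ i \<le> 1"
  shows "\<bar>real (card (integral_points \<Delta>)) - real (card (integral_points ((+) (- v) ` \<Delta>)))\<bar>
    \<le> CARD('n) * (2 * diameter \<Delta> + 1) ^ (CARD('n) - 1)"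
    (is "_ \<le> _ * ?B")
proof -
  define T where "T K = (+) (- (\<chi> i. if i \<in> K then v $ i else 0)) ` \<Delta>" for K
  have "\<bar>real (card (integral_points \<Delta>)) - real (card (integral_points (T K)))\<bar> \<le> card K * ?B"
    if "finite K" for K
    using that
  proof (induction K)
    case empty
    have "T {} = \<Delta>" by (simp add: T_def zero_vec_def[symmetric])
    then show ?case by simp
  next
    case (insert k K)
    have T: "T (insert k K) = (+) (- axis k (v $ k)) ` T K"
      unfolding T_def image_image using insert.hyps
      by (intro image_cong) (auto simp: vec_eq_iff axis_def)
    have "diameter (T K) = diameter \<Delta>"
      unfolding T_def by (rule diameter_translation)
    moreover have "convex (T K)" "bounded (T K)"
      unfolding T_def by (intro convex_translation con bounded_translation bdd)+
    ultimately have "\<bar>real (card (integral_points (T K))) - real (card (integral_points (T (insert k K))))\<bar> \<le> ?B"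
      unfolding T using card_integral_points_axis_translate[of "T K" "v $ k" k] v by simp
    then show ?case using insert by (simp add: algebra_simps)
  qed
  from this[of UNIV] show ?thesis by (simp add: T_def)
qed

section \<open>Lattice points and volume\<close>

text \<open>The unit cells cut \<Delta> into pieces. Once all pieces are moved into the cube
  \<open>Q\<close>, the number of them covering \<open>x\<close> is the number of lattice points of
  \<Delta> - x, and integrating over \<open>x\<close> yields the volume. Each such number is close
  to the one for \<Delta>.\<close>

lemma card_integral_points_approx:
  fixes \<Delta> :: "(real ^ 'n) set"
  assumes con: "convex \<Delta>" and com: "compact \<Delta>"
  shows "\<bar>real (card (integral_points \<Delta>)) - measure lebesgue \<Delta>\<bar>
    \<le> CARD('n) * (2 * diameter \<Delta> + 1) ^ (CARD('n) - 1)" (is "_ \<le> ?C")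
proof -
  note bdd = compact_imp_bounded[OF com]
  \<comment> \<open>The cube is half open so that its lattice translates tile the space without
    overlap, with \<open>fl x\<close> as the corner of the cell of \<open>x\<close>.\<close>
  define Q where "Q = {x :: real ^ 'n. \<forall>i. 0 \<le> x $ i \<and> x $ i < 1}"
  define fl where "fl = (\<lambda>x :: real ^ 'n. \<chi> i. real_of_int \<lfloor>x $ i\<rfloor>)"
  define Z where "Z = fl ` \<Delta>"
  \<comment> \<open>\<open>Z\<close> consists of the corners of the cells meeting \<Delta>, and
    \<open>E z\<close> is the piece of \<Delta> in the cell at \<open>z\<close>, moved back to
    \<open>Q\<close>.\<close>
  define E where "E z = {x \<in> Q. z + x \<in> \<Delta>}" for z
  have fl_Q: "x - fl x \<in> Q" for x
    by (auto simp: Q_def fl_def) linarith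
  have fl_unique: "fl (z + x) = z" if "x \<in> Q" "\<And>i. z $ i \<in> \<int>" for x z
  proof -
    have "\<lfloor>z $ i + x $ i\<rfloor> = \<lfloor>z $ i\<rfloor>" "real_of_int \<lfloor>z $ i\<rfloor> = z $ i" for i
      using that(2)[of i] that(1) by (auto simp: Q_def elim!: Ints_cases) (metis add.commute floor_add_int floor_eq_iff add_0 of_int_0)+
    then show ?thesis by (simp add: fl_def vec_eq_iff)
  qed
  have Z_int: "z $ i \<in> \<int>" if "z \<in> Z" for z i
    using that by (auto simp: Z_def fl_def)
  have finZ: "finite Z"
  \<comment> \<open>Rounding down changes the difference of two coordinates by less than 1, hence
    the summand 1 in \<open>w\<close>.\<close>
  proof (rule card_integral_vectors_le(1)[where I = UNIV and w = "diameter \<Delta> + 1"])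
    fix x y i assume "x \<in> Z" "y \<in> Z"
    then obtain x' y' where "x' \<in> \<Delta>" "y' \<in> \<Delta>" "x = fl x'" "y = fl y'" by (auto simp: Z_def)
    moreover from this have "\<bar>x' $ i - y' $ i\<bar> \<le> diameter \<Delta>"
      using component_diff_le_diameter[OF bdd] by blast
    ultimately show "\<bar>x $ i - y $ i\<bar> \<le> diameter \<Delta> + 1"
      by (simp add: fl_def) linarith
  qed (use diameter_ge_0[OF bdd] Z_int in \<open>auto simp: vec_eq_iff\<close>)

  have Q_borel [measurable]: "Q \<in> sets borel"
  proof -
    have "Q = (\<Inter>i. {x. 0 \<le> x $ i} \<inter> {x. x $ i < 1})" by (auto simp: Q_def)
    also have "\<dots> \<in> sets borel"
      by (intro sets.finite_INT sets.Int borel_closed borel_open closed_halfspace_component_ge_cart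
          open_halfspace_component_lt_cart) auto
    finally show ?thesis .
  qed
  have Q_meas: "measure lborel Q = 1" and Q_fin: "emeasure lborel Q < \<infinity>"
  proof -
    \<comment> \<open>\<open>Q\<close> is squeezed between the open and the closed unit box, both of
      measure 1.\<close>
    have b: "box 0 (1 :: real ^ 'n) \<subseteq> Q" and c: "Q \<subseteq> cbox 0 (1 :: real ^ 'n)"
      by (auto simp: Q_def mem_box_cart less_imp_le)
    have le: "\<forall>b\<in>Basis. (0 :: real ^ 'n) \<bullet> b \<le> 1 \<bullet> b"
      by (auto simp: Basis_vec_def inner_axis)
    have prod1: "(\<Prod>b\<in>Basis. ((1 :: real ^ 'n) - 0) \<bullet> b) = 1"
      by (intro prod.neutral) (auto simp: Basis_vec_def inner_axis)
    have "emeasure lborel (box 0 (1 :: real ^ 'n)) = 1" "emeasure lborel (cbox 0 (1 :: real ^ 'n)) = 1"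
      using le prod1 by (simp_all add: emeasure_lborel_box_eq emeasure_lborel_cbox_eq)
    then have "emeasure lborel Q = 1"
      using emeasure_mono[OF b, of lborel] emeasure_mono[OF c, of lborel] Q_borel by (simp add: antisym)
    then show "measure lborel Q = 1" "emeasure lborel Q < \<infinity>" by (simp_all add: measure_def)
  qed
  have D_borel [measurable]: "\<Delta> \<in> sets borel" using com by (simp add: borel_compact)
  have E_borel [measurable]: "E z \<in> sets borel" for z
  proof -
    have "E z = Q \<inter> ((+) z -` \<Delta> \<inter> space borel)" by (auto simp: E_def)
    also have "\<dots> \<in> sets borel" by measurable
    finally show ?thesis .
  qed
  have E_fin: "emeasure lborel (E z) < \<infinity>" for z
    using emeasure_mono[of "E z" Q lborel] Q_fin by (auto simp: E_def intro: le_less_trans)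
  have part: "\<Delta> = (\<Union>z\<in>Z. (+) z ` E z)"
  proof (rule set_eqI)
    fix x show "x \<in> \<Delta> \<longleftrightarrow> x \<in> (\<Union>z\<in>Z. (+) z ` E z)"
    proof
      assume "x \<in> \<Delta>"
      then have "fl x \<in> Z" "x - fl x \<in> E (fl x)" "x = fl x + (x - fl x)"
        using fl_Q[of x] by (auto simp: Z_def E_def)
      then show "x \<in> (\<Union>z\<in>Z. (+) z ` E z)" by blast
    qed (auto simp: E_def)
  qed
  have tr: "(+) z ` E z \<in> sets borel" "emeasure lborel ((+) z ` E z) = emeasure lborel (E z)" for z
  proof -
    \<comment> \<open>Written as a preimage under a translation, the piece inherits measurability,
      and invariance of \<open>lborel\<close> gives its measure.\<close>
    have eq: "(+) z ` E z = (+) (- z) -` E z \<inter> space borel" by (force simp: image_iff)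
    show "(+) z ` E z \<in> sets borel" unfolding eq by measurable
    show "emeasure lborel ((+) z ` E z) = emeasure lborel (E z)"
      unfolding eq by (subst (2) lborel_distr_plus[of "- z", symmetric]) (simp add: emeasure_distr)
  qed
  have disj: "disjoint_family_on (\<lambda>z. (+) z ` E z) Z"
    unfolding disjoint_family_on_def
  proof (intro ballI impI equals0I)
    fix m n y assume mn: "m \<in> Z" "n \<in> Z" "m \<noteq> n" and "y \<in> (+) m ` E m \<inter> (+) n ` E n"
    then obtain u w where "u \<in> Q" "w \<in> Q" "y = m + u" "y = n + w" by (auto simp: E_def)
    then show False using fl_unique[of u m] fl_unique[of w n] mn Z_int by auto
  qed
  have "measure lebesgue \<Delta> = measure lborel \<Delta>" by simp
  also have "\<dots> = (\<Sum>z\<in>Z. measure lborel ((+) z ` E z))"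
    by (subst part, rule measure_finite_Union[OF finZ _ disj]) (use tr E_fin in \<open>auto simp: less_top\<close>)
  also have "\<dots> = (\<Sum>z\<in>Z. measure lborel (E z))" by (simp add: measure_def tr)
  also have "\<dots> = (LINT x|lborel. (\<Sum>z\<in>Z. indicator (E z) x))"
    using E_fin by (subst Bochner_Integration.integral_sum) auto
  finally have vol: "measure lebesgue \<Delta> = (LINT x|lborel. (\<Sum>z\<in>Z. indicator (E z) x))" .
  have count: "(\<Sum>z\<in>Z. indicator (E z) x) = real (card (integral_points ((+) (- x) ` \<Delta>)))" if "x \<in> Q" for x
  proof -
    have "(\<Sum>z\<in>Z. indicator (E z) x) = real (card (Z \<inter> {z. x \<in> E z}))"
      using finZ by (simp add: indicator_def sum.If_cases)
    also have "Z \<inter> {z. x \<in> E z} = integral_points ((+) (- x) ` \<Delta>)"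
    proof (intro set_eqI iffI)
      fix z assume "z \<in> Z \<inter> {z. x \<in> E z}"
      then show "z \<in> integral_points ((+) (- x) ` \<Delta>)"
        using Z_int by (force simp: integral_points_def E_def image_iff intro!: bexI[of _ "z + x"])
    next
      fix z assume "z \<in> integral_points ((+) (- x) ` \<Delta>)"
      then have z: "z + x \<in> \<Delta>" "\<And>i. z $ i \<in> \<int>" by (auto simp: integral_points_def)
      \<comment> \<open>Summing over \<open>Z\<close> alone misses no lattice point, because
        \<open>z\<close> is the corner of the cell containing \<open>z + x\<close>.\<close>
      then have "z \<in> Z" using fl_unique[OF that z(2)] by (force simp: Z_def image_iff)
      then show "z \<in> Z \<inter> {z. x \<in> E z}" using that z by (auto simp: E_def)
    qed
    finally show ?thesis .
  qed
  let ?N = "real (card (integral_points \<Delta>))"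
  \<comment> \<open>Since \<open>Q\<close> has measure 1, the constant \<open>?N\<close> is the
    integral of \<open>?N * indicator Q x\<close>. Off \<open>Q\<close> both terms of the integrand
    vanish, as every \<open>E z\<close> is contained in \<open>Q\<close>.\<close>
  have "?N - measure lebesgue \<Delta> = (LINT x|lborel. ?N * indicator Q x - (\<Sum>z\<in>Z. indicator (E z) x))"
    unfolding vol using E_fin Q_fin Q_meas by (subst Bochner_Integration.integral_diff) auto
  also have "\<bar>\<dots>\<bar> \<le> (LINT x|lborel. ?C * indicator Q x)"
    unfolding real_norm_def[symmetric]
  proof (rule Bochner_Integration.integral_norm_bound_integral)
    fix x :: "real ^ 'n"
    show "norm (?N * indicator Q x - (\<Sum>z\<in>Z. indicator (E z) x)) \<le> ?C * indicator Q x"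
    proof (cases "x \<in> Q")
      case True
      then show ?thesis
        using card_integral_points_translate[OF con bdd, of x] count[OF True] by (auto simp: Q_def less_imp_le)
    next
      case False
      then show ?thesis by (auto simp: E_def)
    qed
  qed (use E_fin Q_fin in auto)
  also have "\<dots> = ?C" using Q_meas by simp
  finally show ?thesis .
qed

section \<open>Sieving by primes\<close>

text \<open>A factor \<open>p\<close> does not affect divisibility by a different prime, so the
  conditions imposed by \<open>S\<close> survive division by \<open>p\<close>.\<close>

lemma bij_betw_scale_integral_points:
  fixes \<Delta> :: "(real ^ 'n) set" and p :: int
  assumes p: "prime p" and S: "\<And>q. q \<in> S \<Longrightarrow> prime q" "p \<notin> S"
  shows "bij_betw (\<lambda>x. x /\<^sub>R real_of_int p)
    {x \<in> integral_points \<Delta>. (\<forall>q\<in>S. \<not> (\<forall>i. q dvd \<lfloor>x $ i\<rfloor>)) \<and> (\<forall>i. p dvd \<lfloor>x $ i\<rfloor>)}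
    {x \<in> integral_points ((\<lambda>x. x /\<^sub>R real_of_int p) ` \<Delta>). \<forall>q\<in>S. \<not> (\<forall>i. q dvd \<lfloor>x $ i\<rfloor>)}"
    (is "bij_betw ?f ?A ?B")
proof (rule bij_betw_byWitness[where f' = "\<lambda>x. real_of_int p *\<^sub>R x"])
  have p0: "p \<noteq> 0" using p by auto
  have dvd: "q dvd p * m \<longleftrightarrow> q dvd m" if "q \<in> S" for q m
    using that S p by (metis dvd_mult prime_dvd_mult_iff primes_dvd_imp_eq)
  show "\<forall>x\<in>?A. real_of_int p *\<^sub>R ?f x = x" "\<forall>x\<in>?B. ?f (real_of_int p *\<^sub>R x) = x"
    using p0 by auto
  show "?f ` ?A \<subseteq> ?B"
  proof (rule image_subsetI)
    fix x assume x: "x \<in> ?A"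
    then have "\<forall>i. \<exists>m. \<lfloor>x $ i\<rfloor> = p * m" by (auto simp: dvd_def)
    then obtain m where m: "\<And>i. \<lfloor>x $ i\<rfloor> = p * m i" by metis
    have "x $ i = real_of_int (p * m i)" for i
      using x m[of i] by (auto simp: integral_points_def) (metis Ints_cases floor_of_int of_int_mult)
    then have fx: "?f x $ i = real_of_int (m i)" for i using p0 by simp
    show "?f x \<in> ?B"
      using x unfolding mem_Collect_eq integral_points_def fx m by (auto simp: dvd)
  qed
  show "(\<lambda>x. real_of_int p *\<^sub>R x) ` ?B \<subseteq> ?A"
  proof (rule image_subsetI)
    fix y assume y: "y \<in> ?B"
    then have "\<forall>i. \<exists>m. y $ i = real_of_int m" unfolding integral_points_def by (blast elim: Ints_cases)
    then obtain m where m: "\<And>i. y $ i = real_of_int (m i)" by metis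
    have py: "(real_of_int p *\<^sub>R y) $ i = real_of_int (p * m i)" for i by (simp add: m)
    have "real_of_int p *\<^sub>R y \<in> \<Delta>" using y p0 by (auto simp: integral_points_def)
    then show "real_of_int p *\<^sub>R y \<in> ?A"
      using y unfolding mem_Collect_eq integral_points_def py m floor_of_int by (auto simp: dvd)
  qed
qed

text \<open>Induction on the set of primes, with the constant doubling at each prime. The error is
  measured by \<open>2 * diameter \<Delta> + 1\<close> because the induction hypothesis is also
  applied to \<Delta> / p, whose diameter may drop below 1.\<close>

lemma card_integral_points_sieve_approx:
  assumes "finite S" "\<And>p. p \<in> S \<Longrightarrow> prime (p :: int)"
  shows "\<exists>C. \<forall>\<Delta> :: (real ^ 'n) set. convex \<Delta> \<and> compact \<Delta> \<longrightarrow>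
    \<bar>real (card {x \<in> integral_points \<Delta>. \<forall>q\<in>S. \<not> (\<forall>i. q dvd \<lfloor>x $ i\<rfloor>)})
      - (\<Prod>p\<in>S. 1 - 1 / real_of_int p ^ CARD('n)) * measure lebesgue \<Delta>\<bar>
    \<le> C * (2 * diameter \<Delta> + 1) ^ (CARD('n) - 1)"
  using assms
proof (induction S)
  case empty
  show ?case using card_integral_points_approx[where 'n = 'n] by (auto intro!: exI)
next
  case (insert p S)
  define N where "N \<Delta> = real (card {x \<in> integral_points \<Delta>. \<forall>q\<in>S. \<not> (\<forall>i. q dvd \<lfloor>x $ i\<rfloor>)})"
    for \<Delta> :: "(real ^ 'n) set"
  define P where "P = (\<Prod>p\<in>S. 1 - 1 / real_of_int p ^ CARD('n))"
  obtain C where C: "\<And>\<Delta> :: (real ^ 'n) set. convex \<Delta> \<Longrightarrow> compact \<Delta> \<Longrightarrow>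
      \<bar>N \<Delta> - P * measure lebesgue \<Delta>\<bar> \<le> C * (2 * diameter \<Delta> + 1) ^ (CARD('n) - 1)"
    using insert unfolding N_def P_def by auto
  have p: "prime p" using insert by auto
  have p1: "1 \<le> real_of_int p" using prime_gt_1_int[OF p] by simp
  show ?case
  \<comment> \<open>One error term comes from \<Delta> and one from \<Delta> / p. The absolute value
    makes the constant nonnegative, so that the diameter of \<Delta> / p can be replaced by the
    larger one of \<Delta>.\<close>
  proof (intro exI[of _ "2 * \<bar>C\<bar>"] allI impI, elim conjE)
    fix \<Delta> :: "(real ^ 'n) set" assume con: "convex \<Delta>" and com: "compact \<Delta>"
    note bdd = compact_imp_bounded[OF com]
    let ?D = "(\<lambda>x. x /\<^sub>R real_of_int p) ` \<Delta>"
    let ?B = "(2 * diameter \<Delta> + 1) ^ (CARD('n) - 1)"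
    let ?M = "{x \<in> integral_points \<Delta>. \<forall>q\<in>insert p S. \<not> (\<forall>i. q dvd \<lfloor>x $ i\<rfloor>)}"
    let ?K = "{x \<in> integral_points \<Delta>. (\<forall>q\<in>S. \<not> (\<forall>i. q dvd \<lfloor>x $ i\<rfloor>)) \<and> (\<forall>i. p dvd \<lfloor>x $ i\<rfloor>)}"
    have fin: "finite (integral_points \<Delta>)" by (rule finite_integral_points[OF bdd])
    have "{x \<in> integral_points \<Delta>. \<forall>q\<in>S. \<not> (\<forall>i. q dvd \<lfloor>x $ i\<rfloor>)} = ?M \<union> ?K" by auto
    then have "N \<Delta> = real (card ?M) + real (card ?K)"
      unfolding N_def using fin by (simp add: card_Un_disjoint disjoint_iff)
    also have "card ?K = card {x \<in> integral_points ?D. \<forall>q\<in>S. \<not> (\<forall>i. q dvd \<lfloor>x $ i\<rfloor>)}"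
      by (rule bij_betw_same_card[OF bij_betw_scale_integral_points[OF p]]) (use insert in auto)
    finally have M: "real (card ?M) = N \<Delta> - N ?D" by (simp add: N_def)
    have conD: "convex ?D" and comD: "compact ?D"
      using con com by (auto intro: convex_scaling compact_scaling)
    have D0: "0 \<le> diameter ?D" using diameter_ge_0[OF compact_imp_bounded[OF comD]] .
    have "diameter ?D \<le> diameter \<Delta>"
    proof (rule diameter_le)
      show "?D \<noteq> {} \<or> 0 \<le> diameter \<Delta>" using diameter_ge_0[OF bdd] by auto
      fix x y assume "x \<in> ?D" "y \<in> ?D"
      then obtain x' y' where xy: "x' \<in> \<Delta>" "y' \<in> \<Delta>" "x = x' /\<^sub>R real_of_int p" "y = y' /\<^sub>R real_of_int p"
        by auto
      have "norm (x - y) = norm (x' - y') / real_of_int p"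
        using p1 xy by (simp add: scaleR_diff_right[symmetric] divide_inverse_commute)
      also have "\<dots> \<le> norm (x' - y')" using p1 by (simp add: divide_le_eq mult_left_le mult_le_cancel_left1)
      also have "\<dots> \<le> diameter \<Delta>" using diameter_bounded_bound[OF bdd xy(1,2)] by (simp add: dist_norm)
      finally show "norm (x - y) \<le> diameter \<Delta>" .
    qed
    then have BD: "(2 * diameter ?D + 1) ^ (CARD('n) - 1) \<le> ?B"
      using D0 by (intro power_mono) auto
    \<comment> \<open>This scaling of the volume produces the new factor of the product: removing
      the points divisible by \<open>p\<close> multiplies the main term by 1 - 1/p^n.\<close>
    have vD: "measure lebesgue ?D = measure lebesgue \<Delta> / real_of_int p ^ CARD('n)"
      using measure_lebesgue_affine[of "inverse (real_of_int p)" 0 \<Delta>] p1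
      by (simp add: power_inverse divide_inverse_commute)
    have "\<bar>N \<Delta> - P * measure lebesgue \<Delta>\<bar> \<le> \<bar>C\<bar> * ?B"
      using C[OF con com] diameter_ge_0[OF bdd] by (elim order_trans) (intro mult_right_mono, auto)
    moreover have "\<bar>N ?D - P * measure lebesgue ?D\<bar> \<le> \<bar>C\<bar> * ?B"
      using C[OF conD comD] BD D0 by (elim order_trans) (intro mult_mono, auto)
    moreover have "real (card ?M) - (\<Prod>p\<in>insert p S. 1 - 1 / real_of_int p ^ CARD('n)) * measure lebesgue \<Delta>
      = (N \<Delta> - P * measure lebesgue \<Delta>) - (N ?D - P * measure lebesgue ?D)"
      unfolding M vD using insert by (simp add: P_def algebra_simps)
    ultimately show "\<bar>real (card ?M) - (\<Prod>p\<in>insert p S. 1 - 1 / real_of_int p ^ CARD('n)) * measure lebesgue \<Delta>\<bar>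
      \<le> 2 * \<bar>C\<bar> * ?B" by linarith
  qed
qed

section \<open>The gcd condition and the final error term\<close>

text \<open>As \<open>b\<close> is nonzero, so is the gcd, and a nonzero gcd differs from 1 exactly
  when some prime divides it. Such a prime divides \<open>b\<close>, which leaves finitely many
  primes to sieve by.\<close>

lemma coprime_points_eq:
  fixes \<Delta> :: "(real ^ 'n) set"
  assumes "b \<noteq> 0"
  shows "coprime_points \<Delta> b =
    {x \<in> integral_points \<Delta>. \<forall>q\<in>{p. prime p \<and> p dvd b}. \<not> (\<forall>i. q dvd \<lfloor>x $ i\<rfloor>)}"
proof -
  have "Gcd (insert b (range g)) = 1 \<longleftrightarrow> (\<forall>q\<in>{p. prime p \<and> p dvd b}. \<not> (\<forall>i. q dvd g i))"
    for g :: "'n \<Rightarrow> int"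
  proof -
    have "Gcd (insert b (range g)) \<noteq> 0" using assms by auto
    then have "Gcd (insert b (range g)) = 1 \<longleftrightarrow> \<not> (\<exists>q. prime q \<and> q dvd Gcd (insert b (range g)))"
      by (metis is_unit_normalize normalize_Gcd not_prime_unit dvd_1_left prime_divisor_exists)
    moreover have "q dvd Gcd (insert b (range g)) \<longleftrightarrow> q dvd b \<and> (\<forall>i. q dvd g i)" for q
      unfolding dvd_Gcd_iff by auto
    ultimately show ?thesis by blast
  qed
  then show ?thesis by (simp add: coprime_points_def)
qed

theorem theorem2p1:
  fixes b :: int
  assumes "b \<noteq> 0"
  shows "\<exists>C::real. \<forall>\<Delta>::(real ^ 'n) set.
           convex \<Delta> \<and> compact \<Delta> \<and> aff_dim \<Delta> = int CARD('n) \<and> diameter \<Delta> \<ge> 1 \<longrightarrow>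
           \<bar>real (card (coprime_points \<Delta> b))
             - (\<Prod>p\<in>{p::int. prime p \<and> p dvd b}. 1 - 1 / real_of_int p ^ CARD('n))
               * measure lebesgue \<Delta>\<bar>
           \<le> C * diameter \<Delta> ^ (CARD('n) - 1)"
proof -
  let ?S = "{p::int. prime p \<and> p dvd b}"
  have "finite ?S" using finite_divisors_int[OF assms] by (rule finite_subset[rotated]) auto
  from card_integral_points_sieve_approx[OF this, where 'n = 'n]
  obtain C where C: "\<And>\<Delta> :: (real ^ 'n) set. convex \<Delta> \<Longrightarrow> compact \<Delta> \<Longrightarrow>
      \<bar>real (card (coprime_points \<Delta> b)) - (\<Prod>p\<in>?S. 1 - 1 / real_of_int p ^ CARD('n)) * measure lebesgue \<Delta>\<bar>
      \<le> C * (2 * diameter \<Delta> + 1) ^ (CARD('n) - 1)"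
    unfolding coprime_points_eq[OF assms] by auto
  show ?thesis
  \<comment> \<open>For diameter at least 1, \<open>2 * diameter \<Delta> + 1\<close> is at most
    \<open>3 * diameter \<Delta>\<close>; this accounts for the power of 3.\<close>
  proof (intro exI[of _ "\<bar>C\<bar> * 3 ^ (CARD('n) - 1)"] allI impI, elim conjE)
    fix \<Delta> :: "(real ^ 'n) set" assume "convex \<Delta>" "compact \<Delta>" and d: "1 \<le> diameter \<Delta>"
    note C[OF this(1,2)]
    also have "C * (2 * diameter \<Delta> + 1) ^ (CARD('n) - 1) \<le> \<bar>C\<bar> * (3 * diameter \<Delta>) ^ (CARD('n) - 1)"
      using d by (intro mult_mono power_mono) auto
    finally show "\<bar>real (card (coprime_points \<Delta> b)) - (\<Prod>p\<in>?S. 1 - 1 / real_of_int p ^ CARD('n)) * measure lebesgue \<Delta>\<bar>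
      \<le> \<bar>C\<bar> * 3 ^ (CARD('n) - 1) * diameter \<Delta> ^ (CARD('n) - 1)"
      by (simp add: power_mult_distrib mult.assoc)
  qed
qed

end
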